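(* Let $(H,\circ)$ be an LA-semihypergroup with pure left identity. Suppose that for every left hyperideal $L$ of $H$ and every right hyperideal $R$ of $H$ one has $L\cup R=L\circ R$, and that every right hyperideal $R$ of $H$ is semiprime. Then $H$ is intra-regular.
   Context: A hyperoperation on a non-empty set $H$ is a map $\circ: H\times H\to \mathcal{P}(H)\setminus\{\emptyset\}$. For non-empty $A,B\subseteq H$, $A\circ B=\bigcup_{a\in A,\,b\in B}a\circ b$, and singletons are identified with their elements. $(H,\circ)$ is an LA-semihypergroup if $(x\circ y)\circ z=(z\circ y)\circ x$ for all $x,y,z\in H$. An element $e\in H$ is a pure left identity if $e\circ a=\{a\}$ for all $a\in H$. A non-empty subset $I\subseteq H$ is a left (resp. right) hyperideal if $H\circ I\subseteq I$ (resp. $I\circ H\subseteq I$). Write $a^2=a\circ a$. A non-empty subset $A\subseteq H$ is semiprime if for every $a\in H$, $a^2\subseteq A$ implies $a\in A$. $H$ is intra-regular if for every $a\in H$ there exist $x,y\in H$ with $a\in (x\circ a^2)\circ y$. *)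

theory Defs
  imports Main
begin

text \<open>
  A hyperoperation is a function \<open>f :: 'a \<Rightarrow> 'a \<Rightarrow> 'a set\<close> considered only on a carrier set \<open>H\<close>;
  the identification of elements with singletons is made explicit by writing \<open>{x}\<close>.
\<close>

definition hyperoperation_on :: "'a set \<Rightarrow> ('a \<Rightarrow> 'a \<Rightarrow> 'a set) \<Rightarrow> bool" where
  "hyperoperation_on H f \<longleftrightarrow>
     H \<noteq> {} \<and> (\<forall>x\<in>H. \<forall>y\<in>H. f x y \<subseteq> H \<and> f x y \<noteq> {})"

definition set_hyperop :: "('a \<Rightarrow> 'a \<Rightarrow> 'a set) \<Rightarrow> 'a set \<Rightarrow> 'a set \<Rightarrow> 'a set" where
  "set_hyperop f A B = (\<Union>a\<in>A. \<Union>b\<in>B. f a b)"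

definition la_semihypergroup :: "'a set \<Rightarrow> ('a \<Rightarrow> 'a \<Rightarrow> 'a set) \<Rightarrow> bool" where
  "la_semihypergroup H f \<longleftrightarrow>
     hyperoperation_on H f \<and>
     (\<forall>x\<in>H. \<forall>y\<in>H. \<forall>z\<in>H. set_hyperop f (f x y) {z} = set_hyperop f (f z y) {x})"

definition pure_left_identity :: "'a set \<Rightarrow> ('a \<Rightarrow> 'a \<Rightarrow> 'a set) \<Rightarrow> 'a \<Rightarrow> bool" where
  "pure_left_identity H f e \<longleftrightarrow> e \<in> H \<and> (\<forall>a\<in>H. f e a = {a})"

definition left_hyperideal :: "'a set \<Rightarrow> ('a \<Rightarrow> 'a \<Rightarrow> 'a set) \<Rightarrow> 'a set \<Rightarrow> bool" where
  "left_hyperideal H f I \<longleftrightarrow> I \<noteq> {} \<and> I \<subseteq> H \<and> set_hyperop f H I \<subseteq> I"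

definition right_hyperideal :: "'a set \<Rightarrow> ('a \<Rightarrow> 'a \<Rightarrow> 'a set) \<Rightarrow> 'a set \<Rightarrow> bool" where
  "right_hyperideal H f I \<longleftrightarrow> I \<noteq> {} \<and> I \<subseteq> H \<and> set_hyperop f I H \<subseteq> I"

definition semiprime_subset :: "'a set \<Rightarrow> ('a \<Rightarrow> 'a \<Rightarrow> 'a set) \<Rightarrow> 'a set \<Rightarrow> bool" where
  "semiprime_subset H f A \<longleftrightarrow>
     A \<noteq> {} \<and> A \<subseteq> H \<and> (\<forall>a\<in>H. f a a \<subseteq> A \<longrightarrow> a \<in> A)"

definition intra_regular :: "'a set \<Rightarrow> ('a \<Rightarrow> 'a \<Rightarrow> 'a set) \<Rightarrow> bool" where
  "intra_regular H f \<longleftrightarrow>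
     (\<forall>a\<in>H. \<exists>x\<in>H. \<exists>y\<in>H. a \<in> set_hyperop f (set_hyperop f {x} (f a a)) {y})"

end

theory Submission
  imports Defs
begin

text \<open>
  With a pure left identity, \<open>A\<^sup>2 \<circ> H = H \<circ> A\<^sup>2\<close> by the paramedial law, and this set equals
  \<open>(H \<circ> A\<^sup>2) \<circ> H\<close>. For \<open>A = {a}\<close> it is thus a right hyperideal containing \<open>a\<^sup>2 = e \<circ> a\<^sup>2\<close>; being
  semiprime it contains \<open>a\<close>, and \<open>a \<in> (H \<circ> a\<^sup>2) \<circ> H\<close> is intra-regularity at \<open>a\<close>.
\<close>

lemma set_hyperop_mono:
  "A \<subseteq> A' \<Longrightarrow> B \<subseteq> B' \<Longrightarrow> set_hyperop f A B \<subseteq> set_hyperop f A' B'"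
  unfolding set_hyperop_def by blast

lemma set_hyperop_singletons [simp]: "set_hyperop f {a} {b} = f a b"
  unfolding set_hyperop_def by simp

locale LA_semihypergroup =
  fixes H :: "'a set" and f :: "'a \<Rightarrow> 'a \<Rightarrow> 'a set"
  assumes la: "la_semihypergroup H f"
begin

abbreviation hprod :: "'a set \<Rightarrow> 'a set \<Rightarrow> 'a set" (infixl "\<bullet>" 70) where
  "A \<bullet> B \<equiv> set_hyperop f A B"

lemma hprod_closed: "A \<subseteq> H \<Longrightarrow> B \<subseteq> H \<Longrightarrow> A \<bullet> B \<subseteq> H"
  using la unfolding la_semihypergroup_def hyperoperation_on_def set_hyperop_def by blast

text \<open>The elementwise law lifts to sets because every element of a triple product already lies
  in a product of three single elements.\<close>

lemma hprod_left_invertive: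
  assumes "A \<subseteq> H" "B \<subseteq> H" "C \<subseteq> H"
  shows "A \<bullet> B \<bullet> C = C \<bullet> B \<bullet> A"
proof -
  \<comment> \<open>Keeping both outer factors general lets one inclusion serve twice: exchanging
    \<open>P\<close> and \<open>Q\<close> gives the converse.\<close>
  have "P \<bullet> B \<bullet> Q \<subseteq> Q \<bullet> B \<bullet> P" if PQ: "P \<subseteq> H" "Q \<subseteq> H" for P Q
  proof
    fix t assume "t \<in> P \<bullet> B \<bullet> Q"
    then obtain p b q where pbq: "p \<in> P" "b \<in> B" "q \<in> Q" and "t \<in> f p b \<bullet> {q}"
      unfolding set_hyperop_def by blast
    moreover have "f p b \<bullet> {q} = f q b \<bullet> {p}"
      using la pbq PQ assms(2) unfolding la_semihypergroup_def by blast
    ultimately have "t \<in> f q b \<bullet> {p}" by simp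
    then show "t \<in> Q \<bullet> B \<bullet> P"
      using pbq unfolding set_hyperop_def by blast
  qed
  with assms show ?thesis by blast
qed

text \<open>Treat \<open>C \<bullet> D\<close> as one factor and rotate it to the front, exchange
  \<open>C\<close> and \<open>B\<close> by the left invertive law, then rotate back.\<close>

lemma hprod_medial:
  assumes "A \<subseteq> H" "B \<subseteq> H" "C \<subseteq> H" "D \<subseteq> H"
  shows "(A \<bullet> B) \<bullet> (C \<bullet> D) = (A \<bullet> C) \<bullet> (B \<bullet> D)"
proof -
  have "(A \<bullet> B) \<bullet> (C \<bullet> D) = C \<bullet> D \<bullet> B \<bullet> A"
    using assms by (intro hprod_left_invertive hprod_closed)
  also have "\<dots> = B \<bullet> D \<bullet> C \<bullet> A"
    using assms by (simp add: hprod_left_invertive[of C D B])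
  also have "\<dots> = (A \<bullet> C) \<bullet> (B \<bullet> D)"
    using assms by (intro hprod_left_invertive hprod_closed)
  finally show ?thesis .
qed

end

locale LA_semihypergroup_left_id = LA_semihypergroup +
  fixes e
  assumes left_id: "pure_left_identity H f e"
begin

lemma hprod_left_id:
  assumes "A \<subseteq> H" shows "{e} \<bullet> A = A"
  using left_id assms unfolding pure_left_identity_def set_hyperop_def by auto

lemma left_id_subset: "{e} \<subseteq> H"
  using left_id unfolding pure_left_identity_def by simp

text \<open>This allows \<open>H\<close> to be split into two factors, so that the four-factor laws
  apply to products of three sets.\<close>

lemma hprod_carrier: "H \<bullet> H = H"
proof
  show "H \<bullet> H \<subseteq> H" by (simp add: hprod_closed)
  show "H \<subseteq> H \<bullet> H"
    using hprod_left_id[of H] set_hyperop_mono[OF left_id_subset subset_refl, of f H] by simp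
qed

text \<open>This is the medial law with \<open>{e}\<close> as its first factor.\<close>

lemma hprod_left_commute:
  assumes "A \<subseteq> H" "B \<subseteq> H" "C \<subseteq> H"
  shows "A \<bullet> (B \<bullet> C) = B \<bullet> (A \<bullet> C)"
  using hprod_medial[OF left_id_subset assms] assms by (simp add: hprod_left_id)

lemma hprod_paramedial:
  assumes "A \<subseteq> H" "B \<subseteq> H" "C \<subseteq> H" "D \<subseteq> H"
  shows "(A \<bullet> B) \<bullet> (C \<bullet> D) = (D \<bullet> C) \<bullet> (B \<bullet> A)"
proof -
  \<comment> \<open>Moving \<open>C\<close> outside brings \<open>A\<close>, \<open>B\<close> and
    \<open>D\<close> together, where the left invertive law can exchange \<open>A\<close> and
    \<open>D\<close>.\<close>
  have "(A \<bullet> B) \<bullet> (C \<bullet> D) = C \<bullet> (A \<bullet> B \<bullet> D)"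
    using assms by (intro hprod_left_commute hprod_closed)
  also have "\<dots> = C \<bullet> (D \<bullet> B \<bullet> A)"
    using assms by (simp add: hprod_left_invertive[of A B D])
  also have "\<dots> = (D \<bullet> B) \<bullet> (C \<bullet> A)"
    using assms by (intro hprod_left_commute hprod_closed)
  also have "\<dots> = (D \<bullet> C) \<bullet> (B \<bullet> A)"
    using assms by (intro hprod_medial)
  finally show ?thesis .
qed

text \<open>Writing \<open>H\<close> as \<open>H \<bullet> H\<close>, the paramedial law reverses
  all four factors; both pairs are unchanged by the reversal.\<close>

lemma square_hprod_carrier:
  assumes "A \<subseteq> H"
  shows "A \<bullet> A \<bullet> H = H \<bullet> (A \<bullet> A)"
  using hprod_paramedial[of A A H H] assms by (simp add: hprod_carrier)

lemma carrier_square_carrier: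
  assumes "A \<subseteq> H"
  shows "H \<bullet> (A \<bullet> A) \<bullet> H = H \<bullet> (A \<bullet> A)"
proof -
  have S: "A \<bullet> A \<subseteq> H" using assms by (intro hprod_closed)
  \<comment> \<open>The last \<open>H\<close> is split as \<open>H \<bullet> H\<close>; the medial
    law then collects two copies of \<open>H\<close> on the left, which merge again.\<close>
  have "H \<bullet> (A \<bullet> A) \<bullet> H = H \<bullet> (A \<bullet> A \<bullet> H)"
    using hprod_medial[of H "A \<bullet> A" H H] S by (simp add: hprod_carrier)
  also have "\<dots> = A \<bullet> A \<bullet> H"
    using hprod_left_commute[of H "A \<bullet> A" H] S by (simp add: hprod_carrier)
  finally show ?thesis using assms by (simp add: square_hprod_carrier)
qed

lemma square_subset_carrier_square:
  assumes "A \<subseteq> H"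
  shows "A \<bullet> A \<subseteq> H \<bullet> (A \<bullet> A)"
  using hprod_left_id[OF hprod_closed[OF assms assms]]
    set_hyperop_mono[OF left_id_subset subset_refl, of f "A \<bullet> A"] by simp

lemma semiprime_imp_intra_regular:
  assumes semiprime: "\<And>R. right_hyperideal H f R \<Longrightarrow> semiprime_subset H f R"
  shows "intra_regular H f"
  unfolding intra_regular_def
proof
  fix a assume a: "a \<in> H"
  then have A: "{a} \<subseteq> H" by simp
  let ?R = "H \<bullet> f a a"
  \<comment> \<open>The set lemmas are used at \<open>{a}\<close>, where
    \<open>{a} \<bullet> {a}\<close> simplifies to \<open>f a a\<close>.\<close>
  have sub: "f a a \<subseteq> ?R" and eq: "?R \<bullet> H = ?R"
    using square_subset_carrier_square[OF A] carrier_square_carrier[OF A] by simp_all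
  have "f a a \<noteq> {}"
    using la a unfolding la_semihypergroup_def hyperoperation_on_def by blast
  moreover have "?R \<subseteq> H"
    using hprod_closed[OF subset_refl hprod_closed[OF A A]] by simp
  ultimately have "right_hyperideal H f ?R"
    unfolding right_hyperideal_def using sub eq by auto
  then have "a \<in> ?R"
    using semiprime sub a unfolding semiprime_subset_def by blast
  \<comment> \<open>Membership in \<open>?R\<close> yields only the left witness \<open>x\<close>;
    the extra factor \<open>H\<close> provides \<open>y\<close>.\<close>
  then have "a \<in> ?R \<bullet> H" using eq by simp
  then show "\<exists>x\<in>H. \<exists>y\<in>H. a \<in> {x} \<bullet> f a a \<bullet> {y}"
    unfolding set_hyperop_def by blast
qed

end

theorem theorem6:
  fixes H :: "'a set" and f :: "'a \<Rightarrow> 'a \<Rightarrow> 'a set"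
  assumes "la_semihypergroup H f"
    and "\<exists>e. pure_left_identity H f e"
    and "\<And>L R. left_hyperideal H f L \<Longrightarrow> right_hyperideal H f R \<Longrightarrow> L \<union> R = set_hyperop f L R"
    and "\<And>R. right_hyperideal H f R \<Longrightarrow> semiprime_subset H f R"
  shows "intra_regular H f"
proof -
  obtain e where "pure_left_identity H f e" using assms(2) by blast
  then interpret LA_semihypergroup_left_id H f e
    using assms(1) by unfold_locales
  show ?thesis using assms(4) by (rule semiprime_imp_intra_regular)
qed

end
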